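(* Let $D$ be the derivation on the polynomial ring $\mathbb{Q}[a,x,y,z]$ determined by $D(a)=az$, $D(z)=xy$, $D(x)=xy$, $D(y)=xy$ (extended by linearity and the Leibniz rule). For $n\ge 1$ let $$L_n(x,y,z)=\sum_{\sigma\in S_n} x^{\mathrm{jump}(\sigma)} y^{\mathrm{des}(\sigma)} z^{\mathrm{lsuc}(\sigma)},$$ and let $L_0(x,y,z)=1$. Then for all $n\ge 0$, $D^n(a)=a\,L_n(x,y,z)$.
   Context: $S_n$ is the set of permutations $\sigma=\sigma_1\cdots\sigma_n$ of $[n]$, with the convention $\sigma_0=0$. A descent is an index $1\le i\le n-1$ with $\sigma_i>\sigma_{i+1}$; $\mathrm{des}(\sigma)$ is their number. A left succession is an index $1\le i\le n$ with $\sigma_{i-1}+1=\sigma_i$; $\mathrm{lsuc}(\sigma)$ is their number. A jump is an index $1\le i\le n$ with $\sigma_i\ge \sigma_{i-1}+2$; $\mathrm{jump}(\sigma)$ is their number. *)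

theory Defs
  imports Complex_Main "HOL-Library.Poly_Mapping" "HOL-Combinatorics.Permutations"
begin

text \<open>Permutation statistics. A permutation \<open>\<sigma>\<close> of \<open>{1..n}\<close> is a function with
  \<open>\<sigma> permutes {1..n}\<close>; such a function fixes every number outside \<open>{1..n}\<close>, so the convention
  \<open>\<sigma> 0 = 0\<close> holds automatically.\<close>

definition des :: "nat \<Rightarrow> (nat \<Rightarrow> nat) \<Rightarrow> nat" where
  "des n \<sigma> = card {i. 1 \<le> i \<and> i < n \<and> \<sigma> i > \<sigma> (i + 1)}"

definition lsuc :: "nat \<Rightarrow> (nat \<Rightarrow> nat) \<Rightarrow> nat" where
  "lsuc n \<sigma> = card {i. 1 \<le> i \<and> i \<le> n \<and> \<sigma> (i - 1) + 1 = \<sigma> i}"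

definition jump :: "nat \<Rightarrow> (nat \<Rightarrow> nat) \<Rightarrow> nat" where
  "jump n \<sigma> = card {i. 1 \<le> i \<and> i \<le> n \<and> \<sigma> i \<ge> \<sigma> (i - 1) + 2}"

definition L :: "nat \<Rightarrow> 'r::comm_semiring_1 \<Rightarrow> 'r \<Rightarrow> 'r \<Rightarrow> 'r" where
  "L n x y z = (if n = 0 then 1
     else (\<Sum>\<sigma> | \<sigma> permutes {1..n}. x ^ jump n \<sigma> * y ^ des n \<sigma> * z ^ lsuc n \<sigma>))"

text \<open>The polynomial ring over the rationals in four indeterminates, as the monoid algebra of the
  free commutative monoid on the four names.\<close>

datatype indet = Ind_a | Ind_x | Ind_y | Ind_z

type_synonym poly4 = "(indet \<Rightarrow>\<^sub>0 nat) \<Rightarrow>\<^sub>0 rat"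

definition Const :: "rat \<Rightarrow> poly4" where
  "Const c = Poly_Mapping.single 0 c"

definition Var :: "indet \<Rightarrow> poly4" where
  "Var v = Poly_Mapping.single (Poly_Mapping.single v 1) 1"

definition derivation :: "(poly4 \<Rightarrow> poly4) \<Rightarrow> bool" where
  "derivation D \<longleftrightarrow>
     (\<forall>p q. D (p + q) = D p + D q) \<and>
     (\<forall>c p. D (Const c * p) = Const c * D p) \<and>
     (\<forall>p q. D (p * q) = D p * q + p * D q)"

text \<open>A derivation is determined by its values on the indeterminates, and these values can be
  prescribed arbitrarily.\<close>

context
  fixes g :: "indet \<Rightarrow> poly4"
begin

private definition pd :: "(indet \<Rightarrow>\<^sub>0 nat) \<Rightarrow> indet \<Rightarrow> poly4" where
  "pd m v = of_nat (Poly_Mapping.lookup m v) *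
     Poly_Mapping.single (m - Poly_Mapping.single v 1) 1 * g v"

private definition dm :: "(indet \<Rightarrow>\<^sub>0 nat) \<Rightarrow> poly4" where
  "dm m = pd m Ind_a + pd m Ind_x + pd m Ind_y + pd m Ind_z"

private definition dd :: "poly4 \<Rightarrow> poly4" where
  "dd p = (\<Sum>m\<in>Poly_Mapping.keys p. Const (Poly_Mapping.lookup p m) * dm m)"

private lemma Const_add: "Const (b + c) = Const b + Const c"
  by (simp add: Const_def single_add)

private lemma Const_mult: "Const (b * c) = Const b * Const c"
  by (simp add: Const_def mult_single)

private lemma Const_0: "Const 0 = 0"
  by (simp add: Const_def)

private lemma monom_eq:
  "Poly_Mapping.single m c = Const c * Poly_Mapping.single m 1"
  by (simp add: Const_def mult_single)

private lemma dd_superset: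
  assumes "finite A" "Poly_Mapping.keys p \<subseteq> A"
  shows "dd p = (\<Sum>m\<in>A. Const (Poly_Mapping.lookup p m) * dm m)"
  unfolding dd_def using assms
  by (intro sum.mono_neutral_left) (auto simp: in_keys_iff Const_0)

private lemma dd_add: "dd (p + q) = dd p + dd q"
proof -
  let ?A = "Poly_Mapping.keys p \<union> Poly_Mapping.keys q"
  have "dd (p + q) = (\<Sum>m\<in>?A. Const (Poly_Mapping.lookup (p + q) m) * dm m)"
    by (rule dd_superset) (auto simp: Poly_Mapping.keys_add)
  also have "\<dots> = (\<Sum>m\<in>?A. Const (Poly_Mapping.lookup p m) * dm m)
      + (\<Sum>m\<in>?A. Const (Poly_Mapping.lookup q m) * dm m)"
    by (simp add: lookup_add Const_add distrib_right sum.distrib)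
  also have "\<dots> = dd p + dd q"
    using dd_superset[of ?A p] dd_superset[of ?A q] by simp
  finally show ?thesis .
qed

private lemma dd_single: "dd (Poly_Mapping.single m c) = Const c * dm m"
  using dd_superset[of "{m}" "Poly_Mapping.single m c"] by simp

private lemma poly4_induct:
  assumes "\<And>m c. P (Poly_Mapping.single m c)"
    and "\<And>p q. P p \<Longrightarrow> P q \<Longrightarrow> P (p + q)"
  shows "P (p::poly4)"
proof -
  have P0: "P 0" using assms(1)[of 0 0] by simp
  have "P (\<Sum>m\<in>A. Poly_Mapping.single m (Poly_Mapping.lookup p m))" if "finite A" for A
    using that by (induction) (auto intro: assms P0)
  moreover have "(\<Sum>m\<in>Poly_Mapping.keys p. Poly_Mapping.single m (Poly_Mapping.lookup p m)) = p"
  proof (rule poly_mapping_eqI)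
    fix k
    show "Poly_Mapping.lookup (\<Sum>m\<in>Poly_Mapping.keys p.
        Poly_Mapping.single m (Poly_Mapping.lookup p m)) k = Poly_Mapping.lookup p k"
      by (simp add: lookup_sum lookup_single when_def sum.delta in_keys_iff)
  qed
  ultimately show ?thesis by (metis finite_keys)
qed

private lemma pd_add:
  "pd (m + l) v = pd m v * Poly_Mapping.single l 1 + Poly_Mapping.single m 1 * pd l v"
proof -
  have *: "of_nat (Poly_Mapping.lookup m v) *
        (Poly_Mapping.single (m + l - Poly_Mapping.single v 1) 1 :: poly4) =
      of_nat (Poly_Mapping.lookup m v) *
        (Poly_Mapping.single (m - Poly_Mapping.single v 1) 1 * Poly_Mapping.single l 1)" for m l
  proof (cases "Poly_Mapping.lookup m v = 0")
    case False
    have "m + l - Poly_Mapping.single v 1 = m - Poly_Mapping.single v 1 + l"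
    proof (rule poly_mapping_eqI)
      fix k
      show "Poly_Mapping.lookup (m + l - Poly_Mapping.single v 1) k =
          Poly_Mapping.lookup (m - Poly_Mapping.single v 1 + l) k"
        using False by (cases "k = v") (simp_all add: lookup_add lookup_minus lookup_single when_def)
    qed
    then show ?thesis by (simp add: mult_single)
  qed simp
  have "pd (m + l) v =
      (of_nat (Poly_Mapping.lookup m v) * Poly_Mapping.single (m + l - Poly_Mapping.single v 1) 1
       + of_nat (Poly_Mapping.lookup l v) * Poly_Mapping.single (l + m - Poly_Mapping.single v 1) 1)
       * g v"
    by (simp add: pd_def lookup_add distrib_right add.commute)
  also have "\<dots> = pd m v * Poly_Mapping.single l 1 + Poly_Mapping.single m 1 * pd l v"
    unfolding * by (simp add: pd_def algebra_simps)
  finally show ?thesis .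
qed

private lemma dm_add:
  "dm (m + l) = dm m * Poly_Mapping.single l 1 + Poly_Mapping.single m 1 * dm l"
  by (simp add: dm_def pd_add algebra_simps)

private lemma dd_mult: "dd (p * q) = dd p * q + p * dd q"
proof (induction p rule: poly4_induct)
  case (1 m c)
  show ?case
  proof (induction q rule: poly4_induct)
    case (1 l b)
    have "dd (Poly_Mapping.single m c * Poly_Mapping.single l b) = Const (c * b) * dm (m + l)"
      by (simp add: mult_single dd_single)
    also have "\<dots> = dd (Poly_Mapping.single m c) * Poly_Mapping.single l b
        + Poly_Mapping.single m c * dd (Poly_Mapping.single l b)"
      unfolding dd_single dm_add Const_mult
      by (subst (2) monom_eq, subst (3) monom_eq) (simp add: algebra_simps)
    finally show ?case .
  next
    case (2 p q)
    then show ?case by (simp add: dd_add algebra_simps)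
  qed
next
  case (2 p q)
  then show ?case by (simp add: dd_add algebra_simps)
qed

private lemma dd_Const: "dd (Const c) = 0"
proof -
  have "dm 0 = 0" by (simp add: dm_def pd_def)
  then show ?thesis by (simp add: Const_def dd_single)
qed

private lemma dd_Var: "dd (Var v) = g v"
proof -
  have "dm (Poly_Mapping.single v 1) = g v"
    by (cases v) (simp_all add: dm_def pd_def lookup_single)
  then show ?thesis by (simp add: Var_def dd_single) (simp add: Const_def)
qed

private lemma derivation_unique:
  assumes D: "derivation D" "\<And>v. D (Var v) = g v"
    and E: "derivation E" "\<And>v. E (Var v) = g v"
  shows "D p = E p"
proof -
  have one: "F 1 = 0" if "derivation F" for F
  proof -
    have "F (1 * 1) = F 1 * 1 + 1 * F 1" using that unfolding derivation_def by blast
    then show ?thesis by simp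
  qed
  have eq_mono: "D (Poly_Mapping.single m 1) = E (Poly_Mapping.single m 1)" for m
  proof (induction "\<Sum>v\<in>{Ind_a, Ind_x, Ind_y, Ind_z}. Poly_Mapping.lookup m v" arbitrary: m)
    case 0
    then have "Poly_Mapping.lookup m v = 0" for v by (cases v) auto
    then have "m = 0" by (intro poly_mapping_eqI) simp
    then show ?case using one[OF D(1)] one[OF E(1)] by simp
  next
    case (Suc k)
    then obtain v where v: "Poly_Mapping.lookup m v \<noteq> 0" by fastforce
    define l where "l = m - Poly_Mapping.single v 1"
    have m: "m = Poly_Mapping.single v 1 + l"
      by (rule poly_mapping_eqI)
        (use v in \<open>auto simp: l_def lookup_add lookup_minus lookup_single when_def\<close>)
    have "k = (\<Sum>v\<in>{Ind_a, Ind_x, Ind_y, Ind_z}. Poly_Mapping.lookup l v)"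
      using Suc(2) unfolding m by (cases v) (simp_all add: lookup_add lookup_single)
    then have IH: "D (Poly_Mapping.single l 1) = E (Poly_Mapping.single l 1)"
      by (rule Suc(1))
    have "Poly_Mapping.single m 1 = Var v * Poly_Mapping.single l 1"
      by (simp add: m Var_def mult_single)
    moreover have "F (Var v * q) = F (Var v) * q + Var v * F q" if "derivation F" for F q
      using that unfolding derivation_def by blast
    note this[OF D(1), of "Poly_Mapping.single l 1"] this[OF E(1), of "Poly_Mapping.single l 1"]
    ultimately show ?case using IH by (simp add: D(2) E(2))
  qed
  show ?thesis
  proof (induction p rule: poly4_induct)
    case (1 m c)
    have "F (Const c * q) = Const c * F q" if "derivation F" for F q
      using that unfolding derivation_def by blast
    note this[OF D(1), of "Poly_Mapping.single m 1"] this[OF E(1), of "Poly_Mapping.single m 1"]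
    then show ?case by (simp only: monom_eq[of m c] eq_mono[of m])
  next
    case (2 p q)
    then show ?case using D E unfolding derivation_def by simp
  qed
qed

lemma derivation_ex1: "\<exists>!D. derivation D \<and> (\<forall>v. D (Var v) = g v)"
proof (rule ex1I[of _ dd])
  have "dd (Const c * p) = Const c * dd p" for c p
    by (simp add: dd_mult dd_Const)
  then have "derivation dd"
    unfolding derivation_def using dd_add dd_mult by blast
  then show *: "derivation dd \<and> (\<forall>v. dd (Var v) = g v)"
    using dd_Var by blast
  fix D assume "derivation D \<and> (\<forall>v. D (Var v) = g v)"
  then show "D = dd" using derivation_unique[of D dd] * by blast
qed

end

end

theory Submission
  imports Defs "HOL-Combinatorics.Multiset_Permutations"
begin

text \<open>Every permutation of \<open>[n + 1]\<close> arises from exactly one permutation \<open>\<sigma>\<close> of \<open>[n]\<close> by inserting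
  \<open>n + 1\<close>. Inserting it between two neighbours other than directly after \<open>n\<close> replaces their factor
  \<open>x\<close>, \<open>y\<close> or \<open>z\<close> by \<open>x * y\<close>, which is its derivative. Two slots remain. Directly after \<open>n\<close> the
  weight is multiplied by \<open>z\<close>, which accounts for \<open>D a = a * z\<close>. At the end, when \<open>n\<close> is not last,
  the weight is multiplied by \<open>x\<close>; this is the derivative of the factor \<open>y\<close> of the descent that
  follows \<open>n\<close>.\<close>

text \<open>The default \<open>y\<close> stands for a descent; it also covers \<open>p = q\<close>,
  which cannot occur between consecutive entries of a permutation.\<close>

definition step_weight :: "'r \<Rightarrow> 'r \<Rightarrow> 'r \<Rightarrow> nat \<Rightarrow> nat \<Rightarrow> 'r" where
  "step_weight x y z p q = (if p + 1 = q then z else if p + 2 \<le> q then x else y)"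

text \<open>The entry preceding the list is a parameter: the start \<open>0\<close> encodes the
  convention \<open>\<sigma> 0 = 0\<close>, and inductions over the list can move the start.\<close>

fun path_weight :: "'r::comm_semiring_1 \<Rightarrow> 'r \<Rightarrow> 'r \<Rightarrow> nat \<Rightarrow> nat list \<Rightarrow> 'r" where
  "path_weight x y z p [] = 1"
| "path_weight x y z p (q # qs) = step_weight x y z p q * path_weight x y z q qs"

definition insert_at :: "nat \<Rightarrow> 'a \<Rightarrow> 'a list \<Rightarrow> 'a list" where
  "insert_at i m xs = take i xs @ m # drop i xs"

lemma insert_at_0 [simp]: "insert_at 0 m xs = m # xs"
  by (simp add: insert_at_def)

lemma insert_at_Suc_Cons [simp]: "insert_at (Suc i) m (q # qs) = q # insert_at i m qs"
  by (simp add: insert_at_def)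

text \<open>As \<open>m\<close> is new, its position splits the list uniquely, which gives
  injectivity. Surjectivity follows by counting: both sides have \<open>fact (card A + 1)\<close>
  elements.\<close>

lemma bij_betw_insert_at:
  assumes "finite A" "m \<notin> A"
  shows "bij_betw (\<lambda>(xs, i). insert_at i m xs) (permutations_of_set A \<times> {..card A})
           (permutations_of_set (insert m A))"
proof -
  let ?f = "\<lambda>(xs, i). insert_at i m xs" and ?P = "permutations_of_set A \<times> {..card A}"
  have inj: "inj_on ?f ?P"
  proof (rule inj_onI, clarsimp)
    fix xs i ys j
    assume xs: "xs \<in> permutations_of_set A" "i \<le> card A"
      and ys: "ys \<in> permutations_of_set A" "j \<le> card A"
      and eq: "insert_at i m xs = insert_at j m ys"
    have m: "m \<notin> set (take i xs)" "m \<notin> set (drop i xs)" "m \<notin> set (take j ys)" "m \<notin> set (drop j ys)"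
      using xs ys assms by (auto dest: in_set_takeD in_set_dropD permutations_of_setD)
    have "take i xs = take j ys" "drop i xs = drop j ys"
      using eq m unfolding insert_at_def by (metis append_Cons_eq_iff)+
    moreover have "length xs = card A" "length ys = card A"
      using xs ys by (auto simp: length_finite_permutations_of_set)
    ultimately show "xs = ys \<and> i = j"
      using xs ys by (metis append_take_drop_id length_take min.absorb2)
  qed
  have sub: "?f ` ?P \<subseteq> permutations_of_set (insert m A)"
  proof clarify
    fix xs i assume "xs \<in> permutations_of_set A"
    then have xs: "set xs = A" "distinct xs" by (auto dest: permutations_of_setD)
    have "set (insert_at i m xs) = insert m (set (take i xs @ drop i xs))"
      unfolding insert_at_def set_append by simp
    moreover have "distinct (insert_at i m xs) \<longleftrightarrow> distinct (m # (take i xs @ drop i xs))"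
      unfolding insert_at_def distinct.simps distinct_append set_append list.set by blast
    ultimately show "insert_at i m xs \<in> permutations_of_set (insert m A)"
      using xs assms by (simp only: append_take_drop_id) (simp add: permutations_of_setI)
  qed
  have "?f ` ?P = permutations_of_set (insert m A)"
    using assms by (intro card_subset_eq sub)
      (simp_all add: card_image inj card_cartesian_product)
  with inj show ?thesis by (simp add: bij_betw_def)
qed

text \<open>Injective because all these functions are the identity outside \<open>set xs\<close>;
  onto because both sets have factorial cardinality.\<close>

lemma bij_betw_permutes_permutations_of_set:
  assumes "distinct xs"
  shows "bij_betw (\<lambda>\<sigma>. map \<sigma> xs) {\<sigma>. \<sigma> permutes set xs} (permutations_of_set (set xs))"
proof -
  let ?f = "\<lambda>\<sigma>. map \<sigma> xs"
  have inj: "inj_on ?f {\<sigma>. \<sigma> permutes set xs}"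
  proof (rule inj_onI, clarsimp, rule ext)
    fix \<sigma> \<tau> i
    assume "\<sigma> permutes set xs" "\<tau> permutes set xs" "\<forall>i\<in>set xs. \<sigma> i = \<tau> i"
    then show "\<sigma> i = \<tau> i" by (cases "i \<in> set xs") (auto simp: permutes_not_in)
  qed
  have sub: "?f ` {\<sigma>. \<sigma> permutes set xs} \<subseteq> permutations_of_set (set xs)"
    using assms by (auto intro!: permutations_of_setI
        simp: permutes_image distinct_map permutes_in_image intro: permutes_inj_on)
  have "?f ` {\<sigma>. \<sigma> permutes set xs} = permutations_of_set (set xs)"
    by (intro card_subset_eq sub) (simp_all add: card_image inj card_permutations)
  with inj show ?thesis by (simp add: bij_betw_def)
qed

lemma path_weight_map:
  assumes "k \<le> n"
  shows "path_weight x y z (\<sigma> k) (map \<sigma> [Suc k..<Suc n]) =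
    (\<Prod>i=Suc k..n. step_weight x y z (\<sigma> (i - 1)) (\<sigma> i))"
  using assms
proof (induction k rule: inc_induct)
  case (step k)
  then have "[Suc k..<Suc n] = Suc k # [Suc (Suc k)..<Suc n]"
    by (simp add: upt_rec)
  with step show ?case
    by (simp add: prod.atLeast_Suc_atMost del: upt_Suc)
qed simp

text \<open>When \<open>f i\<close> and \<open>g i\<close> differ, exactly one of the three cases
  holds, so each weight is a product of three factors that are \<open>1\<close> outside their own
  case.\<close>

lemma prod_step_weight:
  assumes "finite A" "\<And>i. i \<in> A \<Longrightarrow> f i \<noteq> g i"
  shows "(\<Prod>i\<in>A. step_weight x y z (f i) (g i)) =
    x ^ card {i\<in>A. f i + 2 \<le> g i} * y ^ card {i\<in>A. g i < f i} *
    (z :: 'r::comm_semiring_1) ^ card {i\<in>A. f i + 1 = g i}"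
proof -
  have "(\<Prod>i\<in>A. step_weight x y z (f i) (g i)) =
      (\<Prod>i\<in>A. (if f i + 2 \<le> g i then x else 1) * (if g i < f i then y else 1) *
        (if f i + 1 = g i then z else 1))"
    using assms(2) by (intro prod.cong refl) (fastforce simp: step_weight_def)
  also have "\<dots> = (\<Prod>i\<in>A. if f i + 2 \<le> g i then x else 1) * (\<Prod>i\<in>A. if g i < f i then y else 1) *
      (\<Prod>i\<in>A. if f i + 1 = g i then z else 1)"
    by (simp add: prod.distrib)
  finally show ?thesis
    using assms(1) by (simp add: prod.If_cases Int_def)
qed

lemma path_weight_permutation:
  assumes "\<sigma> permutes {1..n}"
  shows "path_weight x y z 0 (map \<sigma> [1..<Suc n]) =
    x ^ jump n \<sigma> * y ^ des n \<sigma> * (z :: 'r::comm_semiring_1) ^ lsuc n \<sigma>"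
proof -
  have [simp]: "\<sigma> 0 = 0" using assms by (auto simp: permutes_def)
  have inj: "inj \<sigma>" using assms by (rule permutes_inj)
  have "path_weight x y z 0 (map \<sigma> [1..<Suc n]) = (\<Prod>i=1..n. step_weight x y z (\<sigma> (i - 1)) (\<sigma> i))"
    using path_weight_map[of 0 n x y z \<sigma>] by simp
  also have "\<dots> = x ^ card {i\<in>{1..n}. \<sigma> (i - 1) + 2 \<le> \<sigma> i} * y ^ card {i\<in>{1..n}. \<sigma> i < \<sigma> (i - 1)} *
      z ^ card {i\<in>{1..n}. \<sigma> (i - 1) + 1 = \<sigma> i}"
    by (intro prod_step_weight) (auto dest: injD[OF inj])
  also have "card {i\<in>{1..n}. \<sigma> i < \<sigma> (i - 1)} = des n \<sigma>"
  proof -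
    \<comment> \<open>The product indexes a descent by its right end, \<open>des\<close> by its left
      end. The right end cannot be \<open>1\<close>, since \<open>\<sigma> 0 = 0\<close>.\<close>
    have "{i\<in>{1..n}. \<sigma> i < \<sigma> (i - 1)} = Suc ` {i. 1 \<le> i \<and> i < n \<and> \<sigma> i > \<sigma> (i + 1)}"
    proof (intro equalityI subsetI)
      fix i assume i: "i \<in> {i\<in>{1..n}. \<sigma> i < \<sigma> (i - 1)}"
      then have "i \<noteq> 1" by (auto intro!: notI)
      with i show "i \<in> Suc ` {i. 1 \<le> i \<and> i < n \<and> \<sigma> i > \<sigma> (i + 1)}"
        by (intro image_eqI[of _ _ "i - 1"]) auto
    qed auto
    then show ?thesis by (simp add: des_def card_image)
  qed
  finally show ?thesis by (simp add: jump_def lsuc_def)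
qed

lemma L_eq_sum_path_weight:
  "L n x y z = (\<Sum>xs\<in>permutations_of_set {1..n}. path_weight x y z 0 xs)"
proof (cases "n = 0")
  case False
  have "set [1..<Suc n] = {1..n}" by auto
  then have bij: "bij_betw (\<lambda>\<sigma>. map \<sigma> [1..<Suc n]) {\<sigma>. \<sigma> permutes {1..n}} (permutations_of_set {1..n})"
    using bij_betw_permutes_permutations_of_set[of "[1..<Suc n]"] by (simp del: upt_Suc)
  have "L n x y z = (\<Sum>\<sigma> | \<sigma> permutes {1..n}. path_weight x y z 0 (map \<sigma> [1..<Suc n]))"
    using False unfolding L_def
    by (auto intro!: sum.cong simp: path_weight_permutation simp del: upt_Suc One_nat_def)
  then show ?thesis by (simp only: sum.reindex_bij_betw[OF bij])
qed (simp add: L_def)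

lemma L_Suc:
  "L (Suc n) x y z = (\<Sum>xs\<in>permutations_of_set {1..n}.
     \<Sum>i\<le>length xs. path_weight x y z 0 (insert_at i (Suc n) xs))"
proof -
  have bij: "bij_betw (\<lambda>(xs, i). insert_at i (Suc n) xs) (permutations_of_set {1..n} \<times> {..n})
      (permutations_of_set {1..Suc n})"
    using bij_betw_insert_at[of "{1..n}" "Suc n"] by (simp add: atLeastAtMostSuc_conv)
  have "L (Suc n) x y z = (\<Sum>(xs, i)\<in>permutations_of_set {1..n} \<times> {..n}.
      path_weight x y z 0 (insert_at i (Suc n) xs))"
    unfolding L_eq_sum_path_weight sum.reindex_bij_betw[OF bij, symmetric]
    by (simp add: case_prod_unfold)
  also have "\<dots> = (\<Sum>xs\<in>permutations_of_set {1..n}. \<Sum>i\<le>n.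
      path_weight x y z 0 (insert_at i (Suc n) xs))"
    by (simp add: sum.cartesian_product)
  \<comment> \<open>With \<open>length xs\<close> as the bound, the inner sum is open to induction
    over the list.\<close>
  also have "\<dots> = (\<Sum>xs\<in>permutations_of_set {1..n}.
     \<Sum>i\<le>length xs. path_weight x y z 0 (insert_at i (Suc n) xs))"
    by (intro sum.cong refl) (simp add: length_finite_permutations_of_set)
  finally show ?thesis .
qed

text \<open>The recurrence for \<open>L\<close> involves only the three step letters; the value
  \<open>D a\<close> enters in the final theorem alone.\<close>

locale descent_jump_derivation =
  fixes D :: "'r::comm_ring_1 \<Rightarrow> 'r" and x y z :: 'r
  assumes D_add: "D (p + q) = D p + D q"
    and D_mult: "D (p * q) = D p * q + p * D q"
    and D_x: "D x = x * y" and D_y: "D y = x * y" and D_z: "D z = x * y"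
begin

lemma D_0: "D 0 = 0"
  using D_add[of 0 0] by simp

lemma D_1: "D 1 = 0"
  using D_mult[of 1 1] by simp

lemma D_sum: "D (sum f A) = (\<Sum>i\<in>A. D (f i))"
  by (induction A rule: infinite_finite_induct) (simp_all add: D_0 D_add)

lemma D_step_weight: "D (step_weight x y z p q) = x * y"
  by (simp add: step_weight_def D_x D_y D_z)

text \<open>The first slot breaks the step from \<open>p\<close> to \<open>q\<close> into one up to
  \<open>m\<close> and a descent to \<open>q\<close>; every later slot leaves that step
  intact.\<close>

lemma sum_insert_at_Cons:
  assumes "q < m"
  shows "(\<Sum>i\<le>length (q # qs). path_weight x y z p (insert_at i m (q # qs))) =
    step_weight x y z p m * y * path_weight x y z q qs +
    step_weight x y z p q * (\<Sum>i\<le>length qs. path_weight x y z q (insert_at i m qs))"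
proof -
  have "step_weight x y z m q = y"
    using assms by (simp add: step_weight_def)
  then show ?thesis
    by (simp add: sum.atMost_Suc_shift sum_distrib_left mult.assoc del: sum.atMost_Suc)
qed

text \<open>Here every step up to \<open>Suc n\<close> is a jump. Each slot before an entry yields
  one Leibniz term, and the slot at the end yields the extra \<open>x\<close>.\<close>

lemma sum_insert_at_without_max:
  assumes "\<forall>q\<in>set (p # qs). q < n"
  shows "(\<Sum>i\<le>length qs. path_weight x y z p (insert_at i (Suc n) qs)) =
    D (path_weight x y z p qs) + x * path_weight x y z p qs"
  using assms
proof (induction qs arbitrary: p)
  case Nil
  then show ?case by (simp add: D_1 step_weight_def)
next
  case (Cons q qs)
  then have "step_weight x y z p (Suc n) = x" "q < Suc n"
    by (auto simp: step_weight_def)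
  with Cons show ?case
    by (simp add: sum_insert_at_Cons D_mult D_step_weight algebra_simps
        del: list.size sum.atMost_Suc)
qed

text \<open>The induction moves the start \<open>p\<close> along the list until it reaches
  \<open>n\<close>; behind \<open>n\<close> the previous lemma takes over.\<close>

lemma sum_insert_at_with_max:
  assumes "\<forall>q\<in>set (p # qs). q \<le> n" "n \<in> set (p # qs)" "distinct (p # qs)"
  shows "(\<Sum>i\<le>length qs. path_weight x y z p (insert_at i (Suc n) qs)) =
    D (path_weight x y z p qs) + z * path_weight x y z p qs"
  using assms
proof (induction qs arbitrary: p)
  case Nil
  \<comment> \<open>Membership forces \<open>p = n\<close>, so the only slot is directly after
    \<open>n\<close>.\<close>
  then show ?case by (simp add: D_1 step_weight_def)
next
  case (Cons q qs)
  have q: "q < Suc n" using Cons.prems by auto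
  show ?case
  proof (cases "p = n")
    case True
    with Cons.prems have "\<forall>q'\<in>set (q # qs). q' < n"
      by (metis distinct.simps(2) le_neq_implies_less list.set_intros(2))
    \<comment> \<open>The slot after \<open>n\<close> gives \<open>z * y\<close>; the surplus
      \<open>x\<close> from the rest of the list, times this \<open>y\<close>, is
      \<open>D y\<close>.\<close>
    moreover from this have "step_weight x y z p q = y" "step_weight x y z p (Suc n) = z"
      using True by (auto simp: step_weight_def)
    ultimately show ?thesis
      by (simp add: sum_insert_at_Cons q sum_insert_at_without_max D_mult D_y algebra_simps
          del: list.size sum.atMost_Suc)
  next
    case False
    with Cons.prems have "step_weight x y z p (Suc n) = x"
      by (auto simp: step_weight_def)
    moreover have "(\<Sum>i\<le>length qs. path_weight x y z q (insert_at i (Suc n) qs)) =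
        D (path_weight x y z q qs) + z * path_weight x y z q qs"
      using False Cons.prems by (intro Cons.IH) auto
    ultimately show ?thesis
      by (simp add: sum_insert_at_Cons q D_mult D_step_weight algebra_simps del: list.size sum.atMost_Suc)
  qed
qed

lemma L_Suc_eq_D: "L (Suc n) x y z = D (L n x y z) + z * L n x y z"
proof -
  have "(\<Sum>i\<le>length xs. path_weight x y z 0 (insert_at i (Suc n) xs)) =
      D (path_weight x y z 0 xs) + z * path_weight x y z 0 xs"
    if "xs \<in> permutations_of_set {1..n}" for xs
    \<comment> \<open>The list \<open>0 # xs\<close> contains its maximum \<open>n\<close> even for
      \<open>n = 0\<close>, where the leading \<open>0\<close> is that maximum.\<close>
    using permutations_of_setD[OF that] by (intro sum_insert_at_with_max) auto
  then show ?thesis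
    by (simp add: L_Suc L_eq_sum_path_weight[of n] D_sum sum.distrib sum_distrib_left)
qed

end

theorem theorem3p4:
  fixes D :: "poly4 \<Rightarrow> poly4" and a x y z :: poly4 and n :: nat
  defines "a \<equiv> Var Ind_a" and "x \<equiv> Var Ind_x" and "y \<equiv> Var Ind_y" and "z \<equiv> Var Ind_z"
  assumes "derivation D"
    and "D a = a * z" and "D z = x * y" and "D x = x * y" and "D y = x * y"
  shows "(D ^^ n) a = a * L n x y z"
proof -
  interpret descent_jump_derivation D x y z
    using assms(5,7-9) unfolding derivation_def by unfold_locales blast+
  show ?thesis
  proof (induction n)
    case 0
    then show ?case by (simp add: L_def)
  next
    case (Suc n)
    \<comment> \<open>By Leibniz, \<open>D (a * L n x y z)\<close> is \<open>a\<close> times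
      \<open>z * L n x y z + D (L n x y z)\<close>.\<close>
    then show ?case by (simp add: D_mult assms(6) L_Suc_eq_D algebra_simps)
  qed
qed

end
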